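(* Every bounded degree-$2$ real polynomial $p:\{-1,1\}^N\rightarrow[-1,1]$ can be estimated using $O(\sqrt{N})$ classical randomized queries: there is a classical randomized algorithm that, on input $x\in\{-1,1\}^N$, queries $O(\sqrt N)$ of the variables $x_i$ and outputs an estimate of $p(x)$ that, with high probability, is correct to within constant additive error.
   Context: The polynomial $p$ is known to the algorithm; it is not assumed to be homogeneous or block-multilinear. A query reveals the value of one variable $x_i$ of the input. The guarantee is for every $x\in\{-1,1\}^N$. "With high probability" means with any prescribed constant probability less than $1$; the constant in the $O$ may depend on this probability and on the (constant) additive error, but not on $N$ or $p$. *)

theory Defs
  imports "HOL-Probability.Probability" "HOL-Library.Poly_Mapping"
begin

text \<open>Real polynomials in the variables \<open>x\<^sub>0, x\<^sub>1, \<dots>\<close>, as finitely supported maps from exponent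
  vectors (monomials) to coefficients.\<close>

type_synonym real_mpoly = "(nat \<Rightarrow>\<^sub>0 nat) \<Rightarrow>\<^sub>0 real"

definition mpoly_vars :: "real_mpoly \<Rightarrow> nat set" where
  "mpoly_vars p = (\<Union>m\<in>Poly_Mapping.keys p. Poly_Mapping.keys m)"

definition monom_degree :: "(nat \<Rightarrow>\<^sub>0 nat) \<Rightarrow> nat" where
  "monom_degree m = (\<Sum>i\<in>Poly_Mapping.keys m. Poly_Mapping.lookup m i)"

definition total_degree :: "real_mpoly \<Rightarrow> nat" where
  "total_degree p = Max (insert 0 (monom_degree ` Poly_Mapping.keys p))"

definition mpoly_eval :: "real_mpoly \<Rightarrow> (nat \<Rightarrow> real) \<Rightarrow> real" where
  "mpoly_eval p x = (\<Sum>m\<in>Poly_Mapping.keys p. Poly_Mapping.lookup p m * (\<Prod>i\<in>Poly_Mapping.keys m. x i ^ Poly_Mapping.lookup m i))"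

definition sign_cube :: "nat \<Rightarrow> (nat \<Rightarrow> real) set" where
  "sign_cube N = {..<N} \<rightarrow>\<^sub>E {- 1, 1}"

text \<open>A deterministic adaptive query algorithm is a decision tree with real outputs. In
  \<open>Query i l r\<close> the variable \<open>x i\<close> is queried, and the computation goes on with \<open>l\<close> if its value
  is \<open>- 1\<close> and with \<open>r\<close> if it is \<open>1\<close>.\<close>

datatype decision_tree = Output real | Query nat decision_tree decision_tree

primrec run :: "decision_tree \<Rightarrow> (nat \<Rightarrow> real) \<Rightarrow> real" where
  "run (Output v) x = v"
| "run (Query i l r) x = (if x i = 1 then run r x else run l x)"

primrec queried_vars :: "decision_tree \<Rightarrow> nat set" where
  "queried_vars (Output v) = {}"
| "queried_vars (Query i l r) = insert i (queried_vars l \<union> queried_vars r)"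

text \<open>The worst-case number of queries; a repeated query of a variable is counted again.\<close>

primrec depth :: "decision_tree \<Rightarrow> nat" where
  "depth (Output v) = 0"
| "depth (Query i l r) = Suc (max (depth l) (depth r))"

text \<open>A randomized query algorithm draws a decision tree at random, independently of the input,
  and runs it. The bound on the number of queries holds for every outcome of the randomness,
  not just in expectation.\<close>

definition randomized_query_algorithm :: "nat \<Rightarrow> real \<Rightarrow> decision_tree pmf \<Rightarrow> bool" where
  "randomized_query_algorithm N T A \<longleftrightarrow>
     (\<forall>t\<in>set_pmf A. queried_vars t \<subseteq> {..<N} \<and> real (depth t) \<le> T)"

end

theory Submission
  imports Defs
begin

text \<open>After adjoining a variable that is always \<open>1\<close>, the polynomial equals \<open>c + z\<^sup>T A z\<close> on the signs,
  with \<open>A\<close> symmetric of size \<open>n = N + 1\<close> and zero diagonal, and boundedness gives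
  \<open>\<Sum>\<^sub>i \<bar>(A y)\<^sub>i\<bar> \<le> 2\<close> for all sign vectors \<open>y\<close>. By Khinchine's inequality the Euclidean norms
  \<open>s\<^sub>i\<close> of the rows of \<open>A\<close> have a sum below \<open>4\<close>, so there is a probability distribution \<open>w\<close> on the
  indices with \<open>s\<^sub>i \<le> 4 w\<^sub>i\<close>. Sample two independent lists of \<open>k\<close> indices from \<open>w\<close> and average
  \<open>A\<^sub>i\<^sub>j z\<^sub>i z\<^sub>j / (w\<^sub>i w\<^sub>j)\<close> over all pairs. The variance has a first-order part
  \<open>(2 / k) \<Sum>\<^sub>i (A z)\<^sub>i\<^sup>2 / w\<^sub>i\<close>, which is \<open>O(\<surd>n / k)\<close> because \<open>\<bar>(A z)\<^sub>i\<bar> \<le> \<surd>n s\<^sub>i\<close>, and a second-order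
  part \<open>(1 / k\<^sup>2) \<Sum>\<^sub>i\<^sub>j A\<^sub>i\<^sub>j\<^sup>2 / (w\<^sub>i w\<^sub>j)\<close>, which is \<open>O(n / k\<^sup>2)\<close> by AM-GM. So \<open>k = O(\<surd>n)\<close> suffices, by
  Chebyshev's inequality.\<close>

subsection \<open>Second moments of sample means\<close>

lemma expectation_bind_finite:
  fixes h :: "'b \<Rightarrow> real"
  assumes "finite (set_pmf p)" and "\<And>a. a \<in> set_pmf p \<Longrightarrow> finite (set_pmf (f a))"
  shows "measure_pmf.expectation (p \<bind> f) h =
           measure_pmf.expectation p (\<lambda>a. measure_pmf.expectation (f a) h)"
  using assms by (simp add: pmf_expectation_bind[of "set_pmf p"] integral_measure_pmf[of "set_pmf p"])

lemma finite_set_replicate_pmf: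
  "finite (set_pmf W) \<Longrightarrow> finite (set_pmf (replicate_pmf k W))"
  using finite_lists_length_eq[of "set_pmf W" k]
  by (simp add: set_replicate_pmf in_lists_conv_set subset_eq)

text \<open>Bias-variance decomposition, with the variance written as second moment minus squared
  mean.\<close>

lemma expectation_square_shift:
  fixes f :: "'a \<Rightarrow> real"
  assumes "finite (set_pmf W)"
  shows "measure_pmf.expectation W (\<lambda>i. (f i + c)\<^sup>2) =
           measure_pmf.expectation W (\<lambda>i. (f i)\<^sup>2) - (measure_pmf.expectation W f)\<^sup>2
           + (measure_pmf.expectation W f + c)\<^sup>2"
  using assms
  by (simp add: power2_sum integrable_measure_pmf_finite mult.commute)

text \<open>Induction on the number of samples: the first draw moves the target from
  \<open>t\<close> to \<open>t - f i\<close>, which is why \<open>t\<close> is arbitrary. Each draw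
  adds one variance.\<close>

lemma expectation_sample_sum:
  fixes f :: "'a \<Rightarrow> real"
  assumes fin: "finite (set_pmf W)"
  shows "measure_pmf.expectation (replicate_pmf k W) (\<lambda>xs. (sum_list (map f xs) - t)\<^sup>2) =
           real k * (measure_pmf.expectation W (\<lambda>i. (f i)\<^sup>2) - (measure_pmf.expectation W f)\<^sup>2)
           + (real k * measure_pmf.expectation W f - t)\<^sup>2"
proof (induction k arbitrary: t)
  case 0
  then show ?case by simp
next
  case (Suc k)
  let ?E = "measure_pmf.expectation W f"
  let ?V = "measure_pmf.expectation W (\<lambda>i. (f i)\<^sup>2) - ?E\<^sup>2"
  have "measure_pmf.expectation (replicate_pmf (Suc k) W) (\<lambda>xs. (sum_list (map f xs) - t)\<^sup>2)
      = measure_pmf.expectation W (\<lambda>i.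
          measure_pmf.expectation (replicate_pmf k W) (\<lambda>xs. (sum_list (map f xs) - (t - f i))\<^sup>2))"
    by (simp add: expectation_bind_finite fin finite_set_replicate_pmf algebra_simps)
  also have "\<dots> = measure_pmf.expectation W (\<lambda>i. real k * ?V + (f i + (real k * ?E - t))\<^sup>2)"
    unfolding Suc.IH by (simp add: algebra_simps)
  also have "\<dots> = real k * ?V + measure_pmf.expectation W (\<lambda>i. (f i + (real k * ?E - t))\<^sup>2)"
    by (simp add: fin integrable_measure_pmf_finite)
  also have "\<dots> = real k * ?V + (?V + (?E + (real k * ?E - t))\<^sup>2)"
    by (simp add: expectation_square_shift[OF fin])
  finally show ?case by (simp add: algebra_simps)
qed

lemma expectation_sample_mean:
  fixes f :: "'a \<Rightarrow> real"
  assumes fin: "finite (set_pmf W)" and k: "k > 0"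
  shows "measure_pmf.expectation (replicate_pmf k W) (\<lambda>xs. (sum_list (map f xs) / real k - t)\<^sup>2)
           \<le> measure_pmf.expectation W (\<lambda>i. (f i)\<^sup>2) / real k + (measure_pmf.expectation W f - t)\<^sup>2"
proof -
  let ?E = "measure_pmf.expectation W f"
  let ?Q = "measure_pmf.expectation W (\<lambda>i. (f i)\<^sup>2)"
  have eq: "(s / real k - t)\<^sup>2 = (s - real k * t)\<^sup>2 / (real k)\<^sup>2" for s
    using k by (simp add: field_simps flip: power_divide)
  have "measure_pmf.expectation (replicate_pmf k W) (\<lambda>xs. (sum_list (map f xs) / real k - t)\<^sup>2)
     = (real k * (?Q - ?E\<^sup>2) + (real k * ?E - real k * t)\<^sup>2) / (real k)\<^sup>2"
    unfolding eq by (simp add: expectation_sample_sum[OF fin])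
  also have "\<dots> = (?Q - ?E\<^sup>2) / real k + (?E - t)\<^sup>2"
    using k by (simp add: field_simps power2_eq_square)
  \<comment> \<open>The variance is relaxed to the second moment, the quantity that is bounded
    later.\<close>
  also have "\<dots> \<le> ?Q / real k + (?E - t)\<^sup>2"
    using k by (simp add: field_simps)
  finally show ?thesis .
qed

text \<open>All \<open>k\<^sup>2\<close> pairs are used although only \<open>2 * k\<close> indices
  are drawn. The nested form is a sample mean over \<open>is\<close> of sample means over
  \<open>js\<close>.\<close>

definition bilinear_mean :: "nat \<Rightarrow> ('a \<Rightarrow> 'b \<Rightarrow> real) \<Rightarrow> 'a list \<Rightarrow> 'b list \<Rightarrow> real" where
  "bilinear_mean k h is js = sum_list (map (\<lambda>i. sum_list (map (h i) js) / real k) is) / real k"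

text \<open>For fixed \<open>js\<close> this is a sample mean over \<open>is\<close>. The second
  moment and the bias that its error bound leaves are squares of sample means over
  \<open>js\<close>, of the rows \<open>h i\<close> with target 0 and of the column means
  \<open>H\<close> with target \<open>m\<close>, so \<open>expectation_sample_mean\<close> applies
  again.\<close>

lemma expectation_bilinear_mean:
  fixes W :: "'a pmf" and V :: "'b pmf"
  assumes W: "finite (set_pmf W)" and V: "finite (set_pmf V)" and k: "k > 0"
  defines "E \<equiv> measure_pmf.expectation W" and "F \<equiv> measure_pmf.expectation V"
  shows "measure_pmf.expectation (pair_pmf (replicate_pmf k W) (replicate_pmf k V))
           (\<lambda>(is, js). (bilinear_mean k h is js - m)\<^sup>2)
         \<le> E (\<lambda>i. F (\<lambda>j. (h i j)\<^sup>2)) / (real k)\<^sup>2 + E (\<lambda>i. (F (h i))\<^sup>2) / real k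
           + F (\<lambda>j. (E (\<lambda>i. h i j))\<^sup>2) / real k + (F (\<lambda>j. E (\<lambda>i. h i j)) - m)\<^sup>2"
proof -
  let ?I = "replicate_pmf k W" and ?J = "replicate_pmf k V"
  let ?G = "measure_pmf.expectation ?J"
  define g where "g js i = sum_list (map (h i) js) / real k" for js i
  define H where "H j = E (\<lambda>i. h i j)" for j
  have finI: "finite (set_pmf ?I)" and finJ: "finite (set_pmf ?J)"
    using W V by (auto intro: finite_set_replicate_pmf)
  have int: "integrable ?J u" "integrable W v" "integrable V w" for u v w :: "_ \<Rightarrow> real"
    using W V finJ by (auto intro: integrable_measure_pmf_finite)
  have swap: "?G (\<lambda>js. E (u js)) = E (\<lambda>i. ?G (\<lambda>js. u js i))" for u :: "_ \<Rightarrow> _ \<Rightarrow> real"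
    unfolding E_def using W finJ
    by (simp add: integral_measure_pmf[of "set_pmf W" W] integrable_measure_pmf_finite)
  have Eg: "E (g js) = sum_list (map H js) / real k" for js
    unfolding g_def H_def E_def
    by (induction js) (simp_all add: int add_divide_distrib)
  have "measure_pmf.expectation (pair_pmf ?I ?J) (\<lambda>(is, js). (bilinear_mean k h is js - m)\<^sup>2)
     = ?G (\<lambda>js. measure_pmf.expectation ?I (\<lambda>is. (sum_list (map (g js) is) / real k - m)\<^sup>2))"
    unfolding pair_commute_pmf[of ?I]
    by (simp add: pair_pmf_def map_bind_pmf expectation_bind_finite finI finJ bilinear_mean_def g_def[abs_def])
  also have "\<dots> \<le> ?G (\<lambda>js. E (\<lambda>i. (g js i)\<^sup>2) / real k + (E (g js) - m)\<^sup>2)"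
    unfolding E_def by (intro integral_mono int expectation_sample_mean W k)
  also have "\<dots> = E (\<lambda>i. ?G (\<lambda>js. (g js i)\<^sup>2)) / real k + ?G (\<lambda>js. (sum_list (map H js) / real k - m)\<^sup>2)"
    by (simp add: int swap Eg)
  also have "\<dots> \<le> E (\<lambda>i. F (\<lambda>j. (h i j)\<^sup>2) / real k + (F (h i))\<^sup>2) / real k
                 + (F (\<lambda>j. (H j)\<^sup>2) / real k + (F H - m)\<^sup>2)"
  proof (intro add_mono divide_right_mono)
    show "E (\<lambda>i. ?G (\<lambda>js. (g js i)\<^sup>2)) \<le> E (\<lambda>i. F (\<lambda>j. (h i j)\<^sup>2) / real k + (F (h i))\<^sup>2)"
      unfolding E_def F_def g_def
      using expectation_sample_mean[OF V k, where t = 0]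
      by (intro integral_mono int) simp
    show "?G (\<lambda>js. (sum_list (map H js) / real k - m)\<^sup>2) \<le> F (\<lambda>j. (H j)\<^sup>2) / real k + (F H - m)\<^sup>2"
      unfolding F_def by (rule expectation_sample_mean[OF V k])
  qed simp
  also have "\<dots> = E (\<lambda>i. F (\<lambda>j. (h i j)\<^sup>2)) / (real k)\<^sup>2 + E (\<lambda>i. (F (h i))\<^sup>2) / real k
           + F (\<lambda>j. (H j)\<^sup>2) / real k + (F H - m)\<^sup>2"
    unfolding E_def by (simp add: int add_divide_distrib power2_eq_square)
  finally show ?thesis by (simp add: H_def[abs_def])
qed

subsection \<open>Khinchine's inequality\<close>

text \<open>The default value 1 outside \<open>F\<close> makes every coordinate of a draw a
  sign.\<close>

definition random_signs :: "'a set \<Rightarrow> ('a \<Rightarrow> real) pmf" where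
  "random_signs F = Pi_pmf F 1 (\<lambda>_. pmf_of_set {-1, 1})"

lemma set_random_signs:
  assumes "finite F" "y \<in> set_pmf (random_signs F)"
  shows "y i \<in> {-1, 1}"
  using assms by (cases "i \<in> F") (auto simp: random_signs_def set_Pi_pmf PiE_dflt_def)

lemma finite_set_random_signs: "finite F \<Longrightarrow> finite (set_pmf (random_signs F))"
  by (auto simp: random_signs_def intro!: finite_subset[OF set_Pi_pmf_subset'] finite_PiE_dflt)

lemma expectation_random_signs_insert:
  fixes h :: "_ \<Rightarrow> real"
  assumes F: "finite F" "x \<notin> F"
  shows "measure_pmf.expectation (random_signs (insert x F)) h =
           measure_pmf.expectation (random_signs F) (\<lambda>y. (h (y(x := 1)) + h (y(x := -1))) / 2)"
proof -
  have fin: "finite (set_pmf (random_signs F))" by (rule finite_set_random_signs[OF F(1)])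
  \<comment> \<open>\<open>Pi_pmf_insert'\<close> draws the new coordinate first; commuting the
    draws makes its two-point average the inner one.\<close>
  have "random_signs (insert x F) =
          random_signs F \<bind> (\<lambda>y. pmf_of_set {-1, 1} \<bind> (\<lambda>s. return_pmf (y(x := s))))"
    unfolding random_signs_def Pi_pmf_insert'[OF F] by (rule bind_commute_pmf)
  then show ?thesis
    by (simp add: expectation_bind_finite fin integral_pmf_of_set add.commute)
qed

text \<open>Averaging over the new sign cancels its odd powers. Both moments go through one
  induction because the cross term of the fourth power contains the second moment of the
  rest.\<close>

lemma random_signs_moments:
  fixes a :: "'a \<Rightarrow> real"
  assumes "finite F"
  shows "measure_pmf.expectation (random_signs F) (\<lambda>y. (\<Sum>i\<in>F. a i * y i)\<^sup>2) = (\<Sum>i\<in>F. (a i)\<^sup>2)"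
    and "measure_pmf.expectation (random_signs F) (\<lambda>y. (\<Sum>i\<in>F. a i * y i) ^ 4) \<le> 3 * (\<Sum>i\<in>F. (a i)\<^sup>2)\<^sup>2"
  using assms
proof (induction F rule: finite_induct)
  case empty
  { case 1 then show ?case by simp }
  { case 2 then show ?case by simp }
next
  case (insert x F)
  let ?E = "measure_pmf.expectation (random_signs F)"
  let ?X = "\<lambda>y. \<Sum>i\<in>F. a i * y i" and ?s = "\<Sum>i\<in>F. (a i)\<^sup>2"
  have int: "integrable (random_signs F) u" for u :: "_ \<Rightarrow> real"
    using insert.hyps by (auto intro: integrable_measure_pmf_finite finite_set_random_signs)
  have upd: "(\<Sum>i\<in>F. a i * (y(x := s)) i) = ?X y" for y s
    using insert.hyps by (intro sum.cong) auto
  {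
    case 1
    have "measure_pmf.expectation (random_signs (insert x F)) (\<lambda>y. (\<Sum>i\<in>insert x F. a i * y i)\<^sup>2)
        = ?E (\<lambda>y. (?X y)\<^sup>2 + (a x)\<^sup>2)"
      unfolding expectation_random_signs_insert[OF insert.hyps]
      using insert.hyps upd by (intro integral_cong_AE) (auto simp: power2_eq_square algebra_simps)
    then show ?case using insert by (simp add: int)
  }
  {
    case 2
    have "((a x + z) ^ 4 + (- a x + z) ^ 4) / 2 = z ^ 4 + 6 * (a x)\<^sup>2 * z\<^sup>2 + (a x) ^ 4" for z
      by (simp add: power4_eq_xxxx power2_eq_square field_simps)
    then have "measure_pmf.expectation (random_signs (insert x F)) (\<lambda>y. (\<Sum>i\<in>insert x F. a i * y i) ^ 4)
        = ?E (\<lambda>y. (?X y) ^ 4 + 6 * (a x)\<^sup>2 * (?X y)\<^sup>2 + (a x) ^ 4)"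
      unfolding expectation_random_signs_insert[OF insert.hyps]
      using insert.hyps upd by (intro integral_cong_AE) auto
    also have "\<dots> = ?E (\<lambda>y. (?X y) ^ 4) + 6 * (a x)\<^sup>2 * ?s + (a x) ^ 4"
      using insert by (simp add: int)
    \<comment> \<open>Raising the coefficient of \<open>(a x) ^ 4\<close> from 1 to 3 completes the
      square.\<close>
    also have "\<dots> \<le> 3 * ?s\<^sup>2 + 6 * (a x)\<^sup>2 * ?s + 3 * (a x) ^ 4"
      using insert.IH(2) insert.hyps by (intro add_mono) auto
    also have "\<dots> = 3 * ((a x)\<^sup>2 + ?s)\<^sup>2"
      by (simp add: power2_eq_square power4_eq_xxxx algebra_simps)
    finally show ?case using insert.hyps by simp
  }
qed

text \<open>A quadratic minus a quartic lies below the absolute value, so second and fourth moments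
  suffice. Scaled to the norm \<open>s\<close>, the constant is
  \<open>1 - 3 * 4 / 27 = 5 / 9\<close>.\<close>

lemma khinchine_L1:
  fixes a :: "'a \<Rightarrow> real"
  assumes "finite F"
  shows "5 / 9 * L2_set a F \<le> measure_pmf.expectation (random_signs F) (\<lambda>y. \<bar>\<Sum>i\<in>F. a i * y i\<bar>)"
proof (cases "L2_set a F = 0")
  case False
  let ?E = "measure_pmf.expectation (random_signs F)"
  let ?X = "\<lambda>y. \<Sum>i\<in>F. a i * y i"
  define s where "s = L2_set a F"
  have s: "s > 0" using False L2_set_nonneg[of a F] by (simp add: s_def order_less_le)
  have s2: "(\<Sum>i\<in>F. (a i)\<^sup>2) = s\<^sup>2" by (simp add: s_def L2_set_def sum_nonneg)
  have int: "integrable (random_signs F) u" for u :: "_ \<Rightarrow> real"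
    using assms by (auto intro: integrable_measure_pmf_finite finite_set_random_signs)
  \<comment> \<open>\<open>4 / 27\<close> is the least possible coefficient: both sides touch at \<open>v = 3 / 2\<close>.\<close>
  have scalar: "v\<^sup>2 - 4 / 27 * v ^ 4 \<le> v" if "v \<ge> 0" for v :: real
  proof -
    have "v - v\<^sup>2 + 4 / 27 * v ^ 4 = 4 / 27 * v * (v - 3 / 2)\<^sup>2 * (v + 3)"
      by (simp add: power2_eq_square power4_eq_xxxx field_simps)
    also have "\<dots> \<ge> 0" using that by simp
    finally show ?thesis by simp
  qed
  have pt: "t\<^sup>2 / s - 4 / 27 * t ^ 4 / s ^ 3 \<le> \<bar>t\<bar>" for t
  proof -
    have "s * ((\<bar>t\<bar> / s)\<^sup>2 - 4 / 27 * (\<bar>t\<bar> / s) ^ 4) \<le> s * (\<bar>t\<bar> / s)"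
      using s by (intro mult_left_mono scalar) auto
    moreover have "s * ((\<bar>t\<bar> / s)\<^sup>2 - 4 / 27 * (\<bar>t\<bar> / s) ^ 4) = t\<^sup>2 / s - 4 / 27 * t ^ 4 / s ^ 3"
      using s by (simp add: power_divide power_even_abs) (simp add: field_simps eval_nat_numeral)
    ultimately show ?thesis using s by simp
  qed
  have "5 / 9 * s = s\<^sup>2 / s - 4 / 27 * (3 * (s\<^sup>2)\<^sup>2) / s ^ 3"
    using s by (simp add: field_simps power2_eq_square power3_eq_cube)
  also have "\<dots> \<le> ?E (\<lambda>y. (?X y)\<^sup>2) / s - 4 / 27 * ?E (\<lambda>y. (?X y) ^ 4) / s ^ 3"
    using random_signs_moments[OF assms, of a] s
    by (intro diff_mono divide_right_mono mult_left_mono) (auto simp: s2)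
  also have "\<dots> = ?E (\<lambda>y. (?X y)\<^sup>2 / s - 4 / 27 * (?X y) ^ 4 / s ^ 3)"
    by (simp add: int)
  also have "\<dots> \<le> ?E (\<lambda>y. \<bar>?X y\<bar>)"
    by (intro integral_mono int pt)
  finally show ?thesis by (simp add: s_def)
qed (simp add: integral_nonneg)

subsection \<open>Bounded quadratic forms\<close>

definition bilinear_form :: "'a set \<Rightarrow> ('a \<Rightarrow> 'a \<Rightarrow> real) \<Rightarrow> ('a \<Rightarrow> real) \<Rightarrow> ('a \<Rightarrow> real) \<Rightarrow> real" where
  "bilinear_form F A x y = (\<Sum>i\<in>F. \<Sum>j\<in>F. A i j * x i * y j)"

lemma bilinear_form_rows:
  "bilinear_form F A x y = (\<Sum>i\<in>F. x i * (\<Sum>j\<in>F. A i j * y j))"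
  by (simp add: bilinear_form_def sum_distrib_left ac_simps)

lemma bilinear_form_commute:
  assumes "\<And>i j. A i j = A j i"
  shows "bilinear_form F A x y = bilinear_form F A y x"
  unfolding bilinear_form_def by (subst sum.swap) (simp add: assms ac_simps)

text \<open>For sign vectors the half sum and half difference have entries in -1, 0, 1, so the mixed
  form is controlled by values of the quadratic form at such points.\<close>

lemma bilinear_form_polarization:
  assumes "\<And>i j. A i j = A j i"
  shows "bilinear_form F A x y =
           bilinear_form F A (\<lambda>i. (x i + y i) / 2) (\<lambda>i. (x i + y i) / 2)
           - bilinear_form F A (\<lambda>i. (x i - y i) / 2) (\<lambda>i. (x i - y i) / 2)"
proof -
  have "bilinear_form F A (\<lambda>i. (x i + y i) / 2) (\<lambda>i. (x i + y i) / 2)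
           - bilinear_form F A (\<lambda>i. (x i - y i) / 2) (\<lambda>i. (x i - y i) / 2)
        = (bilinear_form F A x y + bilinear_form F A y x) / 2"
    unfolding bilinear_form_def sum_subtractf[symmetric] sum.distrib[symmetric] sum_divide_distrib
    by (intro sum.cong refl) (simp add: field_simps)
  then show ?thesis by (simp add: bilinear_form_commute[where x = y and y = x, OF assms])
qed

locale bounded_quadratic =
  fixes F :: "'a set" and A :: "'a \<Rightarrow> 'a \<Rightarrow> real" and c :: real
  assumes finite_F: "finite F"
    and symmetric: "A i j = A j i"
    and diagonal: "A i i = 0"
    and bounded_signs: "(\<And>i. i \<in> F \<Longrightarrow> z i \<in> {-1, 1}) \<Longrightarrow> \<bar>c + bilinear_form F A z z\<bar> \<le> 1"
begin

text \<open>Since the diagonal vanishes, the form is affine in each coordinate, so its value at a zero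
  coordinate is the average of its values at \<open>1\<close> and \<open>- 1\<close>.\<close>

lemma bounded_zero_signs:
  assumes "\<And>i. i \<in> F \<Longrightarrow> z i \<in> {-1, 0, 1}"
  shows "\<bar>c + bilinear_form F A z z\<bar> \<le> 1"
  using assms
proof (induction "card {i\<in>F. z i = 0}" arbitrary: z)
  case 0
  then have "{i\<in>F. z i = 0} = {}" using finite_F by simp
  then show ?case using 0 by (intro bounded_signs) fastforce
next
  case (Suc m)
  then have "{i\<in>F. z i = 0} \<noteq> {}" by force
  then obtain k where k: "k \<in> F" "z k = 0" by blast
  have less: "\<bar>c + bilinear_form F A (z(k := s)) (z(k := s))\<bar> \<le> 1" if s: "s \<in> {-1, 1}" for s
  proof (rule Suc.hyps(1))
    have "{i\<in>F. (z(k := s)) i = 0} = {i\<in>F. z i = 0} - {k}" using s by auto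
    then show "m = card {i\<in>F. (z(k := s)) i = 0}"
      using Suc.hyps(2) k finite_F by simp
    show "(z(k := s)) i \<in> {-1, 0, 1}" if "i \<in> F" for i using Suc.prems that s by auto
  qed
  have "bilinear_form F A (z(k := 1)) (z(k := 1)) + bilinear_form F A (z(k := -1)) (z(k := -1))
      = 2 * bilinear_form F A z z"
    unfolding bilinear_form_def sum.distrib[symmetric] sum_distrib_left
    using k diagonal by (intro sum.cong refl) auto
  then show ?case using less[of 1] less[of "-1"] by auto
qed

text \<open>By polarization the form is a difference of two values of
  \<open>c + bilinear_form F A z z\<close>; the constant \<open>c\<close> cancels and each value
  contributes at most 1.\<close>

lemma bilinear_form_bound:
  assumes "\<And>i. i \<in> F \<Longrightarrow> x i \<in> {-1, 1}" and "\<And>i. i \<in> F \<Longrightarrow> y i \<in> {-1, 1}"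
  shows "\<bar>bilinear_form F A x y\<bar> \<le> 2"
proof -
  have "\<bar>c + bilinear_form F A (\<lambda>i. (x i + y i) / 2) (\<lambda>i. (x i + y i) / 2)\<bar> \<le> 1"
    using assms by (intro bounded_zero_signs) fastforce
  moreover have "\<bar>c + bilinear_form F A (\<lambda>i. (x i - y i) / 2) (\<lambda>i. (x i - y i) / 2)\<bar> \<le> 1"
    using assms by (intro bounded_zero_signs) fastforce
  ultimately show ?thesis
    using bilinear_form_polarization[where x = x and y = y and F = F and A = A, OF symmetric] by linarith
qed

text \<open>Taking for \<open>x\<close> the signs of the row sums turns the sum of absolute values
  into a value of the bilinear form.\<close>

lemma sum_abs_rows_le:
  assumes "\<And>i. i \<in> F \<Longrightarrow> y i \<in> {-1, 1}"
  shows "(\<Sum>i\<in>F. \<bar>\<Sum>j\<in>F. A i j * y j\<bar>) \<le> 2"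
proof -
  define x where "x i = (if (\<Sum>j\<in>F. A i j * y j) \<ge> 0 then 1 else -1 :: real)" for i
  have "(\<Sum>i\<in>F. \<bar>\<Sum>j\<in>F. A i j * y j\<bar>) = bilinear_form F A x y"
    unfolding bilinear_form_rows by (intro sum.cong refl) (auto simp: x_def)
  also have "\<dots> \<le> 2"
    by (rule order.trans[OF abs_ge_self bilinear_form_bound]) (use assms in \<open>auto simp: x_def\<close>)
  finally show ?thesis .
qed

text \<open>Average \<open>sum_abs_rows_le\<close> over random \<open>y\<close> and apply
  Khinchine's inequality to each row: \<open>2 / (5 / 9) = 18 / 5\<close>.\<close>

lemma sum_row_norms_le: "(\<Sum>i\<in>F. L2_set (A i) F) \<le> 18 / 5"
proof -
  let ?E = "measure_pmf.expectation (random_signs F)"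
  have int: "integrable (random_signs F) u" for u :: "_ \<Rightarrow> real"
    using finite_F by (auto intro: integrable_measure_pmf_finite finite_set_random_signs)
  have "5 / 9 * (\<Sum>i\<in>F. L2_set (A i) F) \<le> (\<Sum>i\<in>F. ?E (\<lambda>y. \<bar>\<Sum>j\<in>F. A i j * y j\<bar>))"
    unfolding sum_distrib_left by (intro sum_mono khinchine_L1 finite_F)
  also have "\<dots> = ?E (\<lambda>y. \<Sum>i\<in>F. \<bar>\<Sum>j\<in>F. A i j * y j\<bar>)"
    by (simp add: int)
  also have "\<dots> \<le> ?E (\<lambda>y. 2)"
    using finite_F
    by (intro integral_mono_AE int) (auto simp: AE_measure_pmf_iff intro!: sum_abs_rows_le dest: set_random_signs)
  finally show ?thesis by simp
qed

section \<open>Importance weights on the indices\<close>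

definition weight :: "'a \<Rightarrow> real" where
  "weight i = L2_set (A i) F / 4 + (1 - (\<Sum>j\<in>F. L2_set (A j) F) / 4) / real (card F)"

text \<open>A quarter of the row norms has total at most 9/10. The missing mass, at least 1/10, is
  spread evenly, so even an index with a zero row has positive weight.\<close>

lemma weight_pos: "i \<in> F \<Longrightarrow> weight i > 0"
  using sum_row_norms_le finite_F
  by (auto simp: weight_def card_gt_0_iff intro!: add_nonneg_pos divide_pos_pos)

lemma row_norm_le_weight: "L2_set (A i) F \<le> 4 * weight i"
  using sum_row_norms_le by (simp add: weight_def)

lemma sum_weight: "F \<noteq> {} \<Longrightarrow> (\<Sum>i\<in>F. weight i) = 1"
  using finite_F by (simp add: weight_def sum.distrib card_gt_0_iff flip: sum_divide_distrib)

definition row_pmf :: "'a pmf" where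
  "row_pmf = embed_pmf (\<lambda>i. if i \<in> F then weight i else 0)"

lemma pmf_row_pmf: "F \<noteq> {} \<Longrightarrow> pmf row_pmf i = (if i \<in> F then weight i else 0)"
  unfolding row_pmf_def
proof (rule pmf_embed_pmf)
  assume "F \<noteq> {}"
  have "(\<integral>\<^sup>+ i. ennreal (if i \<in> F then weight i else 0) \<partial>count_space UNIV) = (\<Sum>i\<in>F. ennreal (weight i))"
    using finite_F by (subst nn_integral_count_space'[of F]) auto
  also have "\<dots> = ennreal (\<Sum>i\<in>F. weight i)"
    by (intro sum_ennreal) (auto dest: weight_pos)
  finally show "(\<integral>\<^sup>+ i. ennreal (if i \<in> F then weight i else 0) \<partial>count_space UNIV) = 1"
    using sum_weight[OF \<open>F \<noteq> {}\<close>] by simp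
qed (auto dest: weight_pos)

lemma set_row_pmf: "F \<noteq> {} \<Longrightarrow> set_pmf row_pmf \<subseteq> F"
  by (auto simp: set_pmf_eq pmf_row_pmf split: if_splits)

lemma expectation_row_pmf:
  fixes f :: "'a \<Rightarrow> real"
  assumes "F \<noteq> {}"
  shows "measure_pmf.expectation row_pmf f = (\<Sum>i\<in>F. weight i * f i)"
  using set_row_pmf[OF assms] finite_F
  by (subst integral_measure_pmf[of F]) (auto simp: pmf_row_pmf[OF assms] intro!: sum.cong)

text \<open>By Cauchy-Schwarz one factor of each square is at most
  \<open>4 * weight i * sqrt (card F)\<close>, which cancels the weight; the other factors sum to at
  most 2.\<close>

lemma sum_square_rows_le:
  assumes x: "\<And>i. i \<in> F \<Longrightarrow> x i \<in> {-1, 1}"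
  shows "(\<Sum>i\<in>F. (\<Sum>j\<in>F. A i j * x j)\<^sup>2 / weight i) \<le> 8 * sqrt (card F)"
proof -
  let ?r = "\<lambda>i. \<Sum>j\<in>F. A i j * x j"
  have L2x: "L2_set x F = sqrt (card F)"
  proof -
    have "(\<Sum>i\<in>F. (x i)\<^sup>2) = (\<Sum>i\<in>F. 1)" using x by (intro sum.cong refl) fastforce
    then show ?thesis by (simp add: L2_set_def)
  qed
  have "(?r i)\<^sup>2 / weight i \<le> 4 * sqrt (card F) * \<bar>?r i\<bar>" if i: "i \<in> F" for i
  proof -
    have "\<bar>?r i\<bar> \<le> (\<Sum>j\<in>F. \<bar>A i j\<bar> * \<bar>x j\<bar>)"
      by (rule order.trans[OF sum_abs]) (simp add: abs_mult)
    also have "\<dots> \<le> L2_set (A i) F * L2_set x F"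
      by (rule L2_set_mult_ineq)
    also have "\<dots> \<le> 4 * weight i * sqrt (card F)"
      unfolding L2x by (intro mult_right_mono row_norm_le_weight) simp
    finally have "\<bar>?r i\<bar> * \<bar>?r i\<bar> \<le> 4 * weight i * sqrt (card F) * \<bar>?r i\<bar>"
      by (intro mult_right_mono) auto
    then show ?thesis
      using weight_pos[OF i] by (simp add: field_simps power2_eq_square)
  qed
  then have "(\<Sum>i\<in>F. (?r i)\<^sup>2 / weight i) \<le> (\<Sum>i\<in>F. 4 * sqrt (card F) * \<bar>?r i\<bar>)"
    by (rule sum_mono)
  also have "\<dots> = 4 * sqrt (card F) * (\<Sum>i\<in>F. \<bar>?r i\<bar>)"
    by (simp add: sum_distrib_left)
  also have "\<dots> \<le> 4 * sqrt (card F) * 2"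
    by (intro mult_left_mono sum_abs_rows_le x) auto
  finally show ?thesis by simp
qed

text \<open>AM-GM replaces \<open>1 / (weight i * weight j)\<close> by the mean of the inverse
  squares. By symmetry both halves have the same sum, to which each row contributes at most
  \<open>4\<^sup>2\<close>.\<close>

lemma sum_square_entries_le:
  "(\<Sum>i\<in>F. \<Sum>j\<in>F. (A i j)\<^sup>2 / (weight i * weight j)) \<le> 16 * real (card F)"
proof -
  let ?B = "\<lambda>i j. (A i j)\<^sup>2 / (weight i)\<^sup>2"
  have "(A i j)\<^sup>2 / (weight i * weight j) \<le> (?B i j + ?B j i) / 2" if "i \<in> F" "j \<in> F" for i j
  proof -
    have "1 / (weight i * weight j) \<le> (1 / (weight i)\<^sup>2 + 1 / (weight j)\<^sup>2) / 2"
      using sum_squares_bound[of "1 / weight i" "1 / weight j"] by (simp add: power_divide)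
    then have "(A i j)\<^sup>2 * (1 / (weight i * weight j)) \<le> (A i j)\<^sup>2 * ((1 / (weight i)\<^sup>2 + 1 / (weight j)\<^sup>2) / 2)"
      by (intro mult_left_mono) auto
    then show ?thesis by (simp add: symmetric[of j i] algebra_simps)
  qed
  then have "(\<Sum>i\<in>F. \<Sum>j\<in>F. (A i j)\<^sup>2 / (weight i * weight j)) \<le> (\<Sum>i\<in>F. \<Sum>j\<in>F. (?B i j + ?B j i) / 2)"
    by (intro sum_mono)
  also have "\<dots> = ((\<Sum>i\<in>F. \<Sum>j\<in>F. ?B i j) + (\<Sum>i\<in>F. \<Sum>j\<in>F. ?B j i)) / 2"
    by (simp add: sum.distrib flip: sum_divide_distrib)
  also have "(\<Sum>i\<in>F. \<Sum>j\<in>F. ?B j i) = (\<Sum>i\<in>F. \<Sum>j\<in>F. ?B i j)"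
    by (rule sum.swap)
  also have "((\<Sum>i\<in>F. \<Sum>j\<in>F. ?B i j) + (\<Sum>i\<in>F. \<Sum>j\<in>F. ?B i j)) / 2 = (\<Sum>i\<in>F. (L2_set (A i) F / weight i)\<^sup>2)"
    by (simp add: L2_set_def sum_nonneg power_divide sum_divide_distrib)
  also have "\<dots> \<le> (\<Sum>i\<in>F. 4\<^sup>2)"
    by (intro sum_mono power_mono) (use weight_pos row_norm_le_weight in \<open>auto simp: field_simps L2_set_nonneg less_imp_le\<close>)
  finally show ?thesis by simp
qed

section \<open>The estimator and its mean square error\<close>

definition estimate :: "nat \<Rightarrow> ('a \<Rightarrow> real) \<Rightarrow> 'a list \<Rightarrow> 'a list \<Rightarrow> real" where
  "estimate k x = bilinear_mean k (\<lambda>i j. A i j * x i * x j / (weight i * weight j))"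

text \<open>The estimate depends only on sampled coordinates, so queries to these determine
  it.\<close>

lemma estimate_cong:
  assumes "\<And>i. i \<in> set is \<union> set js \<Longrightarrow> x i = y i"
  shows "estimate k x is js = estimate k y is js"
  unfolding estimate_def bilinear_mean_def
  using assms by (intro arg_cong2[where f = "(/)"] refl arg_cong[where f = sum_list] map_cong) auto

text \<open>Division by the weights makes the estimator unbiased. Of the other terms in
  \<open>expectation_bilinear_mean\<close>, the pair term is bounded by
  \<open>sum_square_entries_le\<close> and the row and column terms by
  \<open>sum_square_rows_le\<close>.\<close>

lemma estimate_mean_square_error:
  assumes x: "\<And>i. i \<in> F \<Longrightarrow> x i \<in> {-1, 1}" and k: "k > 0" and F: "F \<noteq> {}"
  shows "measure_pmf.expectation (pair_pmf (replicate_pmf k row_pmf) (replicate_pmf k row_pmf))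
           (\<lambda>(is, js). (estimate k x is js - bilinear_form F A x x)\<^sup>2)
         \<le> 16 * real (card F) / (real k)\<^sup>2 + 16 * sqrt (card F) / real k"
proof -
  let ?E = "measure_pmf.expectation row_pmf"
  let ?r = "\<lambda>i. \<Sum>j\<in>F. A i j * x j"
  define h where "h i j = A i j * x i * x j / (weight i * weight j)" for i j
  have fin: "finite (set_pmf row_pmf)"
    using set_row_pmf[OF F] finite_F finite_subset by blast
  have x2: "(x i)\<^sup>2 = 1" if "i \<in> F" for i using x[OF that] by auto
  have pos: "weight i \<noteq> 0" if "i \<in> F" for i using weight_pos[OF that] by simp
  have row: "?E (h i) = x i * ?r i / weight i" if "i \<in> F" for i
    unfolding expectation_row_pmf[OF F] h_def sum_distrib_left sum_divide_distrib
    by (intro sum.cong refl) (simp add: pos that)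
  have sym: "h j i = h i j" for i j
    by (simp add: h_def symmetric[of j i] ac_simps)
  have sq: "?E (\<lambda>i. (?E (h i))\<^sup>2) \<le> 8 * sqrt (card F)"
  proof -
    have "?E (\<lambda>i. (?E (h i))\<^sup>2) = (\<Sum>i\<in>F. (?r i)\<^sup>2 / weight i)"
      unfolding expectation_row_pmf[OF F, of "\<lambda>i. (?E (h i))\<^sup>2"]
      by (intro sum.cong refl) (simp add: row power_divide power_mult_distrib x2 pos power2_eq_square[of "weight _"])
    then show ?thesis using sum_square_rows_le[OF x] by simp
  qed
  have entries: "?E (\<lambda>i. ?E (\<lambda>j. (h i j)\<^sup>2)) \<le> 16 * real (card F)"
  proof -
    have "?E (\<lambda>i. ?E (\<lambda>j. (h i j)\<^sup>2)) = (\<Sum>i\<in>F. \<Sum>j\<in>F. (A i j)\<^sup>2 / (weight i * weight j))"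
      unfolding expectation_row_pmf[OF F] sum_distrib_left
      by (intro sum.cong refl)
        (simp add: h_def power_divide power_mult_distrib x2 pos power2_eq_square[of "weight _"])
    then show ?thesis using sum_square_entries_le by simp
  qed
  have mean: "?E (\<lambda>i. ?E (h i)) = bilinear_form F A x x"
    unfolding expectation_row_pmf[OF F, of "\<lambda>i. ?E (h i)"] bilinear_form_rows
    by (intro sum.cong refl) (simp add: row pos)
  have "measure_pmf.expectation (pair_pmf (replicate_pmf k row_pmf) (replicate_pmf k row_pmf))
           (\<lambda>(is, js). (estimate k x is js - bilinear_form F A x x)\<^sup>2)
      \<le> ?E (\<lambda>i. ?E (\<lambda>j. (h i j)\<^sup>2)) / (real k)\<^sup>2 + ?E (\<lambda>i. (?E (h i))\<^sup>2) / real k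
           + ?E (\<lambda>j. (?E (\<lambda>i. h i j))\<^sup>2) / real k
           + (?E (\<lambda>j. ?E (\<lambda>i. h i j)) - bilinear_form F A x x)\<^sup>2"
    using expectation_bilinear_mean[OF fin fin k, of h] by (simp add: estimate_def h_def[abs_def])
  \<comment> \<open>Symmetry of \<open>h\<close> turns column expectations into row expectations,
    and \<open>mean\<close> removes the bias.\<close>
  also have "\<dots> = ?E (\<lambda>i. ?E (\<lambda>j. (h i j)\<^sup>2)) / (real k)\<^sup>2 + 2 * ?E (\<lambda>i. (?E (h i))\<^sup>2) / real k"
    by (subst (2 3) sym) (simp add: mean)
  also have "\<dots> \<le> 16 * real (card F) / (real k)\<^sup>2 + 2 * (8 * sqrt (card F)) / real k"
    using sq entries by (intro add_mono divide_right_mono mult_left_mono) auto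
  finally show ?thesis by simp
qed

end

subsection \<open>Decision trees and degree-2 polynomials\<close>

text \<open>A nonadaptive algorithm as a full binary tree: \<open>z\<close> records the answers, and
  its initial value supplies the coordinates that are never queried.\<close>

primrec query_all :: "nat list \<Rightarrow> ((nat \<Rightarrow> real) \<Rightarrow> real) \<Rightarrow> (nat \<Rightarrow> real) \<Rightarrow> decision_tree" where
  "query_all [] g z = Output (g z)"
| "query_all (i # is) g z = Query i (query_all is g (z(i := -1))) (query_all is g (z(i := 1)))"

lemma depth_query_all: "depth (query_all is g z) = length is"
  by (induction "is" arbitrary: z) simp_all

lemma queried_vars_query_all: "queried_vars (query_all is g z) = set is"
  by (induction "is" arbitrary: z) simp_all

lemma run_query_all:
  assumes "\<And>i. i \<in> set is \<Longrightarrow> x i \<in> {-1, 1}"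
  shows "run (query_all is g z) x = g (\<lambda>i. if i \<in> set is then x i else z i)"
  using assms
proof (induction "is" arbitrary: z)
  case (Cons i "is")
  have "(\<lambda>j. if j \<in> set is then x j else (z(i := x i)) j) = (\<lambda>j. if j \<in> set (i # is) then x j else z j)"
    by auto
  moreover have "run (query_all (i # is) g z) x = run (query_all is g (z(i := x i))) x"
    using Cons.prems[of i] by auto
  ultimately show ?case using Cons by simp
qed simp

text \<open>The variable with index \<open>N\<close> is a dummy with value \<open>1\<close>, which makes the linear terms
  quadratic.\<close>

definition quadratic_on_signs :: "nat \<Rightarrow> ((nat \<Rightarrow> real) \<Rightarrow> real) \<Rightarrow> bool" where
  "quadratic_on_signs N f \<longleftrightarrow>
     (\<exists>c A. (\<forall>i j. A i j = A j i) \<and> (\<forall>i. A i i = 0) \<and>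
        (\<forall>z. (\<forall>i<N. z i \<in> {-1, 1}) \<longrightarrow> z N = 1 \<longrightarrow> f z = c + bilinear_form {..N} A z z))"

section \<open>Degree-2 polynomials as quadratic forms on the signs\<close>

lemma quadratic_on_signs_const: "quadratic_on_signs N (\<lambda>_. c)"
  unfolding quadratic_on_signs_def
  by (intro exI[of _ c] exI[of _ "\<lambda>_ _. 0"]) (simp add: bilinear_form_def)

lemma quadratic_on_signs_pair:
  assumes "i \<noteq> j" "i \<le> N" "j \<le> N"
  shows "quadratic_on_signs N (\<lambda>z. z i * z j)"
proof -
  \<comment> \<open>The coefficient is split into halves at both positions to keep the matrix
    symmetric. One of \<open>i\<close>, \<open>j\<close> may be the dummy index
    \<open>N\<close>.\<close>
  define A :: "nat \<Rightarrow> nat \<Rightarrow> real"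
    where "A k l = (if l = j then if k = i then 1 / 2 else 0 else 0)
                   + (if l = i then if k = j then 1 / 2 else 0 else 0)" for k l
  have row: "(\<Sum>l\<le>N. A k l * z l) = (if k = i then z j / 2 else 0) + (if k = j then z i / 2 else 0)"
    for k z
  proof -
    have "(\<Sum>l\<le>N. A k l * z l) = (\<Sum>l\<le>N. if l = j then (if k = i then z j / 2 else 0) else 0)
                              + (\<Sum>l\<le>N. if l = i then (if k = j then z i / 2 else 0) else 0)"
      unfolding sum.distrib[symmetric] by (intro sum.cong refl) (auto simp: A_def)
    then show ?thesis using assms by (simp add: sum.delta)
  qed
  have "bilinear_form {..N} A z z = z i * z j" for z
  proof -
    have "bilinear_form {..N} A z z = (\<Sum>k\<le>N. if k = i then z i * z j / 2 else 0)
                                    + (\<Sum>k\<le>N. if k = j then z i * z j / 2 else 0)"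
      unfolding bilinear_form_rows row sum.distrib[symmetric] by (intro sum.cong refl) auto
    then show ?thesis using assms by (simp add: sum.delta)
  qed
  then show ?thesis
    using assms unfolding quadratic_on_signs_def
    by (intro exI[of _ 0] exI[of _ A]) (auto simp: A_def)
qed

lemma quadratic_on_signs_add:
  assumes "quadratic_on_signs N f" "quadratic_on_signs N g"
  shows "quadratic_on_signs N (\<lambda>z. f z + g z)"
proof -
  from assms obtain c A d B where
    "\<And>i j. A i j = A j i" "\<And>i. A i i = 0"
    "\<And>z. (\<forall>i<N. z i \<in> {-1, 1}) \<Longrightarrow> z N = 1 \<Longrightarrow> f z = c + bilinear_form {..N} A z z"
    "\<And>i j. B i j = B j i" "\<And>i. B i i = 0"
    "\<And>z. (\<forall>i<N. z i \<in> {-1, 1}) \<Longrightarrow> z N = 1 \<Longrightarrow> g z = d + bilinear_form {..N} B z z"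
    unfolding quadratic_on_signs_def by metis
  then show ?thesis
    unfolding quadratic_on_signs_def
    by (intro exI[of _ "c + d"] exI[of _ "\<lambda>i j. A i j + B i j"])
       (auto simp: bilinear_form_def sum.distrib distrib_right)
qed

lemma quadratic_on_signs_scale:
  assumes "quadratic_on_signs N f"
  shows "quadratic_on_signs N (\<lambda>z. a * f z)"
proof -
  from assms obtain c A where
    "\<And>i j. A i j = A j i" "\<And>i. A i i = 0"
    "\<And>z. (\<forall>i<N. z i \<in> {-1, 1}) \<Longrightarrow> z N = 1 \<Longrightarrow> f z = c + bilinear_form {..N} A z z"
    unfolding quadratic_on_signs_def by metis
  then show ?thesis
    unfolding quadratic_on_signs_def
    by (intro exI[of _ "a * c"] exI[of _ "\<lambda>i j. a * A i j"])
       (auto simp: bilinear_form_def sum_distrib_left algebra_simps)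
qed

lemma quadratic_on_signs_sum:
  assumes "\<And>m. m \<in> M \<Longrightarrow> quadratic_on_signs N (f m)"
  shows "quadratic_on_signs N (\<lambda>z. \<Sum>m\<in>M. f m z)"
  using assms
  by (induction M rule: infinite_finite_induct)
     (auto intro: quadratic_on_signs_const quadratic_on_signs_add)

lemma quadratic_on_signs_cong:
  assumes "quadratic_on_signs N f"
    and "\<And>z. (\<forall>i<N. z i \<in> {-1, 1}) \<Longrightarrow> z N = 1 \<Longrightarrow> g z = f z"
  shows "quadratic_on_signs N g"
  using assms unfolding quadratic_on_signs_def by metis

text \<open>On signs a squared variable is the constant 1, a single variable is its product with the
  dummy, and two distinct variables form a pair.\<close>

lemma quadratic_on_signs_monomial:
  assumes vars: "Poly_Mapping.keys m \<subseteq> {..<N}" and deg: "monom_degree m \<le> 2"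
  shows "quadratic_on_signs N (\<lambda>z. \<Prod>i\<in>Poly_Mapping.keys m. z i ^ Poly_Mapping.lookup m i)"
proof -
  let ?K = "Poly_Mapping.keys m"
  have pos: "Poly_Mapping.lookup m i \<ge> 1" if "i \<in> ?K" for i
    using that by (simp add: in_keys_iff Suc_le_eq)
  have "card ?K = (\<Sum>i\<in>?K. 1)" by simp
  also have "\<dots> \<le> monom_degree m"
    unfolding monom_degree_def by (intro sum_mono pos)
  finally consider "card ?K = 0" | "card ?K = 1" | "card ?K = 2"
    using deg by linarith
  then show ?thesis
  proof cases
    case 1
    then show ?thesis by (simp add: quadratic_on_signs_const)
  next
    case 2
    then obtain i where i: "?K = {i}" by (auto simp: card_1_singleton_iff)
    then have "i < N" and "Poly_Mapping.lookup m i = 1 \<or> Poly_Mapping.lookup m i = 2"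
      using vars deg pos[of i] by (auto simp: monom_degree_def)
    then show ?thesis
    proof (elim disjE)
      assume "i < N" "Poly_Mapping.lookup m i = 1"
      then show ?thesis
        by (intro quadratic_on_signs_cong[OF quadratic_on_signs_pair[of i N N]]) (auto simp: i)
    next
      assume "i < N" "Poly_Mapping.lookup m i = 2"
      then show ?thesis
        by (intro quadratic_on_signs_cong[OF quadratic_on_signs_const[of N 1]]) (fastforce simp: i)
    qed
  next
    case 3
    then obtain i j where ij: "?K = {i, j}" "i \<noteq> j" by (auto simp: card_2_iff)
    then have "Poly_Mapping.lookup m i = 1" "Poly_Mapping.lookup m j = 1"
      using deg pos[of i] pos[of j] by (auto simp: monom_degree_def)
    then show ?thesis
      using ij vars quadratic_on_signs_pair[of i j N] by (simp add: less_imp_le)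
  qed
qed

lemma quadratic_on_signs_mpoly:
  assumes vars: "mpoly_vars p \<subseteq> {..<N}" and deg: "total_degree p \<le> 2"
  shows "quadratic_on_signs N (mpoly_eval p)"
  unfolding mpoly_eval_def
proof (intro quadratic_on_signs_sum quadratic_on_signs_scale quadratic_on_signs_monomial)
  fix m assume m: "m \<in> Poly_Mapping.keys p"
  show "Poly_Mapping.keys m \<subseteq> {..<N}" using vars m by (auto simp: mpoly_vars_def)
  have "monom_degree m \<le> total_degree p" using m by (simp add: total_degree_def)
  then show "monom_degree m \<le> 2" using deg by simp
qed

lemma mpoly_eval_cong:
  assumes "\<And>i. i \<in> mpoly_vars p \<Longrightarrow> x i = y i"
  shows "mpoly_eval p x = mpoly_eval p y"
proof -
  have "x i = y i" if "m \<in> Poly_Mapping.keys p" "i \<in> Poly_Mapping.keys m" for m i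
    using that by (intro assms) (auto simp: mpoly_vars_def)
  then show ?thesis
    unfolding mpoly_eval_def by (intro sum.cong refl arg_cong2[where f = "(*)"] prod.cong) simp
qed

text \<open>The bound on \<open>p\<close> covers only sign vectors with \<open>z N = 1\<close>. The
  form is even, so negating all coordinates reduces \<open>z N = -1\<close> to that case.\<close>

lemma bounded_degree2_polynomial:
  assumes vars: "mpoly_vars p \<subseteq> {..<N}" and deg: "total_degree p \<le> 2"
    and bounded: "\<forall>x\<in>sign_cube N. mpoly_eval p x \<in> {-1..1}"
  obtains A c where "bounded_quadratic {..N} A c"
    and "\<And>x. x \<in> sign_cube N \<Longrightarrow> mpoly_eval p x = c + bilinear_form {..N} A (x(N := 1)) (x(N := 1))"
proof -
  from quadratic_on_signs_mpoly[OF vars deg] obtain c A where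
    sym: "\<And>i j. A i j = A j i" and diag: "\<And>i. A i i = 0" and
    eval: "\<And>z. (\<forall>i<N. z i \<in> {-1, 1}) \<Longrightarrow> z N = 1 \<Longrightarrow> mpoly_eval p z = c + bilinear_form {..N} A z z"
    unfolding quadratic_on_signs_def by metis
  have bound1: "\<bar>c + bilinear_form {..N} A z z\<bar> \<le> 1"
    if z: "\<And>i. i \<in> {..N} \<Longrightarrow> z i \<in> {-1, 1}" "z N = 1" for z
  proof -
    \<comment> \<open>Points of \<open>sign_cube N\<close> are undefined outside
      \<open>{..<N}\<close>, hence the restriction; \<open>p\<close> does not see the
      difference.\<close>
    have "restrict z {..<N} \<in> sign_cube N" using z(1) by (auto simp: sign_cube_def)
    then have "mpoly_eval p (restrict z {..<N}) \<in> {-1..1}" using bounded by blast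
    moreover have "mpoly_eval p (restrict z {..<N}) = mpoly_eval p z"
      using vars by (intro mpoly_eval_cong) auto
    ultimately show ?thesis using eval[of z] z by (auto simp: abs_le_iff)
  qed
  have "bounded_quadratic {..N} A c"
  proof
    fix z :: "nat \<Rightarrow> real" assume z: "\<And>i. i \<in> {..N} \<Longrightarrow> z i \<in> {-1, 1}"
    have neg: "bilinear_form {..N} A (\<lambda>i. - z i) (\<lambda>i. - z i) = bilinear_form {..N} A z z"
      by (simp add: bilinear_form_def)
    show "\<bar>c + bilinear_form {..N} A z z\<bar> \<le> 1"
    proof (cases "z N = 1")
      case True
      then show ?thesis using z by (intro bound1)
    next
      case False
      then have "z N = -1" using z[of N] by auto
      then show ?thesis
        unfolding neg[symmetric] using z by (intro bound1) fastforce+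
    qed
  qed (use sym diag in auto)
  moreover have "mpoly_eval p x = c + bilinear_form {..N} A (x(N := 1)) (x(N := 1))"
    if "x \<in> sign_cube N" for x
  proof -
    have "mpoly_eval p x = mpoly_eval p (x(N := 1))"
      using vars by (intro mpoly_eval_cong) auto
    also have "\<dots> = c + bilinear_form {..N} A (x(N := 1)) (x(N := 1))"
      using that by (intro eval) (auto simp: sign_cube_def PiE_iff)
    finally show ?thesis .
  qed
  ultimately show thesis by (rule that)
qed

section \<open>Chebyshev's inequality and the query algorithm\<close>

lemma prob_close_ge:
  fixes f :: "'a \<Rightarrow> real"
  assumes "finite (set_pmf P)" and \<epsilon>: "\<epsilon> > 0"
  shows "measure_pmf.prob P {s. \<bar>f s\<bar> \<le> \<epsilon>} \<ge> 1 - measure_pmf.expectation P (\<lambda>s. (f s)\<^sup>2) / \<epsilon>\<^sup>2"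
proof -
  have "measure_pmf.prob P (- {s. \<bar>f s\<bar> \<le> \<epsilon>}) \<le> measure_pmf.prob P {s. \<bar>f s\<bar> \<ge> \<epsilon>}"
    by (intro measure_pmf.finite_measure_mono) auto
  also have "\<dots> \<le> measure_pmf.expectation P (\<lambda>s. (f s)\<^sup>2) / \<epsilon>\<^sup>2"
    using measure_pmf.second_moment_method[of f P \<epsilon>] assms
    by (simp add: integrable_measure_pmf_finite)
  finally show ?thesis
    using measure_pmf.prob_compl[of "{s. \<bar>f s\<bar> \<le> \<epsilon>}" P] by (simp add: Compl_eq_Diff_UNIV)
qed

text \<open>The parameter \<open>M\<close> trades queries against failure probability: about
  \<open>M * sqrt (N + 1)\<close> indices per list give mean square error at most
  \<open>32 / M\<close>.\<close>

lemma degree2_polynomial_query_algorithm: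
  fixes M \<epsilon> :: real
  assumes \<epsilon>: "\<epsilon> > 0" and M: "M \<ge> 1"
    and vars: "mpoly_vars p \<subseteq> {..<N}" and deg: "total_degree p \<le> 2"
    and bounded: "\<forall>x\<in>sign_cube N. mpoly_eval p x \<in> {-1..1}"
  obtains T where "randomized_query_algorithm N (8 * M * sqrt (real N)) T"
    and "\<And>x. x \<in> sign_cube N \<Longrightarrow>
           measure_pmf.prob T {t. \<bar>run t x - mpoly_eval p x\<bar> \<le> \<epsilon>} \<ge> 1 - 32 / (M * \<epsilon>\<^sup>2)"
proof (cases "N = 0")
  case True
  \<comment> \<open>For \<open>N = 0\<close> no query is allowed, and the only input is the
    everywhere undefined function.\<close>
  let ?T = "return_pmf (Output (mpoly_eval p (\<lambda>_. undefined)))"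
  show thesis
    using True \<epsilon> M
    by (intro that[of ?T]) (auto simp: randomized_query_algorithm_def sign_cube_def)
next
  case False
  obtain A c where "bounded_quadratic {..N} A c" and
    eval: "\<And>x. x \<in> sign_cube N \<Longrightarrow> mpoly_eval p x = c + bilinear_form {..N} A (x(N := 1)) (x(N := 1))"
    using bounded_degree2_polynomial[OF vars deg bounded] by blast
  then interpret bounded_quadratic "{..N}" A c by blast
  define n where "n = real (N + 1)"
  define k where "k = nat \<lceil>M * sqrt n\<rceil>"
  define P where "P = pair_pmf (replicate_pmf k row_pmf) (replicate_pmf k row_pmf)"
  \<comment> \<open>The dummy \<open>N\<close> is not queried: it is filtered out, and the initial
    assignment 1 supplies its value.\<close>
  define tree where "tree = (\<lambda>(is, js). query_all (filter (\<lambda>i. i < N) (is @ js))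
                                (\<lambda>z. c + estimate k z is js) (\<lambda>_. 1))"
  have n: "n \<ge> 1" by (simp add: n_def)
  then have Mn: "M * sqrt n \<ge> 1" using mult_mono[of 1 M 1 "sqrt n"] M by simp
  have k: "real k \<ge> M * sqrt n" unfolding k_def by linarith
  then have k_pos: "k > 0" using Mn by (cases k) auto
  have set: "set_pmf row_pmf \<subseteq> {..N}" by (rule set_row_pmf) auto
  then have fin: "finite (set_pmf P)"
    unfolding P_def by (auto intro!: finite_set_replicate_pmf intro: finite_subset)
  \<comment> \<open>Rounding gives \<open>k \<le> 2 * M * sqrt n\<close>, and
    \<open>n = N + 1 \<le> 4 * N\<close> since \<open>N\<close> is positive.\<close>
  have "real (2 * k) \<le> 8 * M * sqrt (real N)"
  proof -
    have "n \<le> 2\<^sup>2 * real N" using False by (simp add: n_def)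
    then have "sqrt n \<le> sqrt (2\<^sup>2 * real N)" by (rule real_sqrt_le_mono)
    then have "sqrt n \<le> 2 * sqrt (real N)" by (simp add: real_sqrt_mult)
    then have "M * sqrt n \<le> M * (2 * sqrt (real N))" using M by (intro mult_left_mono) auto
    moreover have "real k \<le> M * sqrt n + 1" unfolding k_def using Mn by linarith
    ultimately show ?thesis using Mn by simp
  qed
  moreover have "depth t \<le> 2 * k \<and> queried_vars t \<subseteq> {..<N}" if t: "t \<in> set_pmf (map_pmf tree P)" for t
  proof -
    obtain s where s: "s \<in> set_pmf P" "t = tree s"
      using t unfolding set_map_pmf by blast
    obtain "is" js where "s = (is, js)" by (cases s)
    then have "t = tree (is, js)" "length is = k" "length js = k"
      using s by (auto simp: P_def set_replicate_pmf)
    then show ?thesis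
      using length_filter_le[of "\<lambda>i. i < N" "is @ js"]
      by (auto simp: tree_def depth_query_all queried_vars_query_all)
  qed
  ultimately have alg: "randomized_query_algorithm N (8 * M * sqrt (real N)) (map_pmf tree P)"
    unfolding randomized_query_algorithm_def by (metis of_nat_mono order.trans)
  have "measure_pmf.prob (map_pmf tree P) {t. \<bar>run t x - mpoly_eval p x\<bar> \<le> \<epsilon>} \<ge> 1 - 32 / (M * \<epsilon>\<^sup>2)"
    if x: "x \<in> sign_cube N" for x
  proof -
    define z where "z = x(N := 1)"
    define f where "f = (\<lambda>(is, js). estimate k z is js - bilinear_form {..N} A z z)"
    have z: "z i \<in> {-1, 1}" if "i \<in> {..N}" for i
      using x that by (auto simp: z_def sign_cube_def PiE_iff)
    have run: "run (tree s) x - mpoly_eval p x = f s" if s: "s \<in> set_pmf P" for s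
    proof -
      obtain "is" js where s_eq: "s = (is, js)" by (cases s)
      \<comment> \<open>Sampled indices do not exceed \<open>N\<close>, so only the dummy is
        filtered out, and there the default 1 agrees with \<open>z\<close>.\<close>
      have in_range: "set is \<union> set js \<subseteq> {..N}"
        using s set by (auto simp: s_eq P_def set_replicate_pmf)
      have "run (tree s) x = c + estimate k (\<lambda>i. if i \<in> set (filter (\<lambda>i. i < N) (is @ js)) then x i else 1) is js"
        unfolding s_eq tree_def prod.case
        using x by (intro run_query_all) (auto simp: sign_cube_def PiE_iff)
      also have "\<dots> = c + estimate k z is js"
        using in_range by (intro arg_cong2[where f = "(+)"] refl estimate_cong) (auto simp: z_def)
      finally show ?thesis by (simp add: eval[OF x] f_def s_eq z_def)
    qed
    have "measure_pmf.expectation P (\<lambda>s. (f s)\<^sup>2) \<le> 16 * n / (real k)\<^sup>2 + 16 * sqrt n / real k"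
      using estimate_mean_square_error[of z k] z k_pos
      by (simp add: P_def f_def n_def case_prod_unfold)
    also have "\<dots> \<le> 16 * n / (M * sqrt n)\<^sup>2 + 16 * sqrt n / (M * sqrt n)"
      using M Mn k n by (intro add_mono divide_left_mono power_mono mult_pos_pos) auto
    also have "\<dots> = 16 / M\<^sup>2 + 16 / M"
      using n M by (simp add: power_mult_distrib)
    also have "\<dots> \<le> 32 / M"
      using M by (simp add: field_simps power2_eq_square)
    finally have "measure_pmf.expectation P (\<lambda>s. (f s)\<^sup>2) / \<epsilon>\<^sup>2 \<le> (32 / M) / \<epsilon>\<^sup>2"
      by (rule divide_right_mono) simp
    then have "1 - 32 / (M * \<epsilon>\<^sup>2) \<le> measure_pmf.prob P {s. \<bar>f s\<bar> \<le> \<epsilon>}"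
      using prob_close_ge[OF fin \<epsilon>, of f] by simp
    also have "\<dots> = measure_pmf.prob P {s. \<bar>run (tree s) x - mpoly_eval p x\<bar> \<le> \<epsilon>}"
      by (intro measure_pmf.finite_measure_eq_AE) (auto simp: AE_measure_pmf_iff run)
    finally show ?thesis by (simp add: vimage_def)
  qed
  with alg show thesis by (rule that)
qed

theorem mainTheorem9:
  fixes \<epsilon> q :: real
  assumes "\<epsilon> > 0" and "q < 1"
  shows "\<exists>C::real. \<forall>(N::nat) (p::real_mpoly).
           mpoly_vars p \<subseteq> {..<N} \<longrightarrow> total_degree p \<le> 2 \<longrightarrow>
           (\<forall>x\<in>sign_cube N. mpoly_eval p x \<in> {-1..1}) \<longrightarrow>
           (\<exists>A. randomized_query_algorithm N (C * sqrt (real N)) A \<and>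
                (\<forall>x\<in>sign_cube N.
                   measure_pmf.prob A {t. \<bar>run t x - mpoly_eval p x\<bar> \<le> \<epsilon>} \<ge> q))"
proof -
  \<comment> \<open>This \<open>M\<close> makes the failure probability at most \<open>1 - q\<close>
    and depends only on \<epsilon> and \<open>q\<close>.\<close>
  define M where "M = max 1 (32 / (\<epsilon>\<^sup>2 * (1 - q)))"
  have M: "M \<ge> 1" and "32 / (\<epsilon>\<^sup>2 * (1 - q)) \<le> M" by (auto simp: M_def)
  then have q: "q \<le> 1 - 32 / (M * \<epsilon>\<^sup>2)"
    using assms by (simp add: field_simps)
  show ?thesis
  proof (intro exI[of _ "8 * M"] allI impI)
    fix N :: nat and p :: real_mpoly
    assume "mpoly_vars p \<subseteq> {..<N}" "total_degree p \<le> 2" "\<forall>x\<in>sign_cube N. mpoly_eval p x \<in> {-1..1}"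
    then obtain T where "randomized_query_algorithm N (8 * M * sqrt (real N)) T"
      and "\<And>x. x \<in> sign_cube N \<Longrightarrow>
             measure_pmf.prob T {t. \<bar>run t x - mpoly_eval p x\<bar> \<le> \<epsilon>} \<ge> 1 - 32 / (M * \<epsilon>\<^sup>2)"
      using degree2_polynomial_query_algorithm[OF assms(1) M] by blast
    then show "\<exists>A. randomized_query_algorithm N (8 * M * sqrt (real N)) A \<and>
                (\<forall>x\<in>sign_cube N.
                   measure_pmf.prob A {t. \<bar>run t x - mpoly_eval p x\<bar> \<le> \<epsilon>} \<ge> q)"
      using q by (blast intro: order.trans)
  qed
qed

end
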